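(* Let $\alpha^{+},\lambda^{+},\alpha^{-},\lambda^{-}\in(0,\infty)$ and $\beta^{+},\beta^{-}\in[0,1)$, let $X\sim \mathrm{TSD}(\alpha^{+},\beta^{+},\lambda^{+};\alpha^{-},\beta^{-},\lambda^{-})$, and let $\nu$ be its Lévy measure. Then for every $f\in\mathcal{S}(\mathbb{R})$, $$\mathbb{E}\left(Xf(X)-\int_{\mathbb{R}}u f(X+u)\,\nu(du)\right)=0.$$
   Context: $\mathcal{S}(\mathbb{R})$ is the Schwartz space of rapidly decreasing $C^\infty$ functions on $\mathbb{R}$. For $\alpha^{+},\lambda^{+},\alpha^{-},\lambda^{-}\in(0,\infty)$ and $\beta^{+},\beta^{-}\in[0,1)$, a random variable $X$ has the two-sided tempered stable distribution $\mathrm{TSD}(\alpha^{+},\beta^{+},\lambda^{+};\alpha^{-},\beta^{-},\lambda^{-})$ if its characteristic function is $\phi(z)=\mathbb{E}e^{izX}=\exp\left(\int_{\mathbb{R}}(e^{izu}-1)\,\nu(du)\right)$, $z\in\mathbb{R}$, with Lévy measure $$\nu(du)=\left(\frac{\alpha^{+}}{u^{1+\beta^{+}}}e^{-\lambda^{+}u}\mathbf{1}_{(0,\infty)}(u)+\frac{\alpha^{-}}{|u|^{1+\beta^{-}}}e^{-\lambda^{-}|u|}\mathbf{1}_{(-\infty,0)}(u)\right)du.$$ *)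

theory Defs
  imports "HOL-Probability.Probability"
begin

definition iter_deriv :: "nat \<Rightarrow> (real \<Rightarrow> 'a::real_normed_vector) \<Rightarrow> real \<Rightarrow> 'a" where
  "iter_deriv n = (\<lambda>g x. vector_derivative g (at x)) ^^ n"

text \<open>\<^const>\<open>vector_derivative\<close> is a choice operator, so smoothness is the differentiability of
  all iterated derivatives.\<close>

definition schwartz_space :: "(real \<Rightarrow> 'a::real_normed_vector) set" where
  "schwartz_space = {f.
     (\<forall>n x. iter_deriv n f differentiable (at x)) \<and>
     (\<forall>m n. bounded (range (\<lambda>x. x ^ m *\<^sub>R iter_deriv n f x)))}"

definition levy_tsd :: "real \<Rightarrow> real \<Rightarrow> real \<Rightarrow> real \<Rightarrow> real \<Rightarrow> real \<Rightarrow> real measure" where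
  "levy_tsd ap bp lp am bm lm = density lborel (\<lambda>u. ennreal (
     ap / (u powr (1 + bp)) * exp (- lp * u) * indicator {0<..} u +
     am / (\<bar>u\<bar> powr (1 + bm)) * exp (- lm * \<bar>u\<bar>) * indicator {..<0} u))"

definition tsd_law ::
  "real measure \<Rightarrow> real \<Rightarrow> real \<Rightarrow> real \<Rightarrow> real \<Rightarrow> real \<Rightarrow> real \<Rightarrow> bool" where
  "tsd_law \<mu> ap bp lp am bm lm \<longleftrightarrow> real_distribution \<mu> \<and>
     (\<forall>z. char \<mu> z = exp (CLINT u|levy_tsd ap bp lp am bm lm. iexp (z * u) - 1))"

end

theory Submission
  imports Defs
begin

text \<open>
  Write \<open>\<mu>\<close> for the law of \<open>X\<close>, \<open>\<phi> = exp \<psi>\<close> for its characteristic function and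
  \<open>\<kappa>(du) = u \<nu>(du)\<close>, a finite signed measure. Since \<open>\<integral> |u| d\<nu>\<close> and \<open>\<integral> u\<^sup>2 d\<nu>\<close> are finite,
  \<open>1 - Re \<phi>(h) = O(h\<^sup>2)\<close>, and Fatou's lemma yields a second moment for \<open>X\<close>. Hence \<open>\<phi>\<close> and \<open>\<psi>\<close> may
  be differentiated under the integral, and \<open>\<phi>' = \<phi> \<psi>'\<close> says that the signed measures
  \<open>x \<mu>(dx)\<close> and \<open>\<mu> * \<kappa>\<close> have the same Fourier transform. By Levy's uniqueness theorem, applied to
  positive and negative parts, they coincide, and it remains to integrate \<open>f\<close>.
\<close>

section \<open>Elementary bounds, and differentiation under the integral sign\<close>

lemma one_minus_cos_le: "1 - cos x \<le> x\<^sup>2 / 2" for x :: real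
proof -
  have "(sin (x/2))\<^sup>2 \<le> (x/2)\<^sup>2"
    using abs_sin_x_le_abs_x[of "x/2"] by (simp only: abs_le_square_iff)
  then show ?thesis
    using cos_double_sin[of "x/2"] by (simp add: power_divide)
qed

lemma norm_iexp_diff_le: "norm (iexp a - iexp b) \<le> \<bar>a - b\<bar>"
proof -
  have "iexp a - iexp b = iexp b * (iexp (a - b) - 1)"
    by (simp add: algebra_simps flip: exp_add)
  then show ?thesis
    using iexp_approx1[of "a - b" 0] by (simp add: norm_mult)
qed

text \<open>Subtracting 1 makes the integrand of size O(|x|), hence integrable even when
  \<open>N\<close> has infinite mass, as a Levy measure may. The same statement thus serves for the
  law of X and for its Levy measure.\<close>

lemma has_vector_derivative_integral_iexp:
  assumes [measurable_cong]: "sets N = sets borel" and int: "integrable N (\<lambda>x. x)"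
  shows "((\<lambda>z. CLINT x|N. iexp (z * x) - 1) has_vector_derivative
    (CLINT x|N. \<i> * x * iexp (z * x))) (at z)"
proof -
  let ?d = "\<lambda>x. \<i> * complex_of_real x * iexp (z * x)"
  \<comment> \<open>\<open>q x y\<close> is the first-order Taylor remainder at z divided by |y -
    z|; the derivative exists as claimed exactly when the integral of \<open>q\<close> tends to 0 as
    y tends to z.\<close>
  define q where "q x y = (1 / norm (y - z)) *\<^sub>R
    (iexp (y * x) - 1 - ((iexp (z * x) - 1) + (y - z) *\<^sub>R ?d x))" for x y
  have [measurable]: "(\<lambda>x. q x y) \<in> borel_measurable N" for y
    unfolding q_def by measurable
  have int_exp: "integrable N (\<lambda>x. iexp (y * x) - 1)" for y
    using norm_iexp_diff_le[of "y * x" 0 for x]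
    by (intro Bochner_Integration.integrable_bound[OF integrable_mult_right[OF int, of y]]) auto
  have int_d: "integrable N ?d"
    by (intro Bochner_Integration.integrable_bound[OF int]) (auto simp: norm_mult)
  have "((\<lambda>y. integral\<^sup>L N (\<lambda>x. q x y)) \<longlongrightarrow> 0) (at z)"
    unfolding tendsto_at_iff_sequentially comp_def
  proof safe
    fix Y :: "nat \<Rightarrow> real" assume Y: "\<forall>i. Y i \<in> UNIV - {z}" "Y \<longlonglongrightarrow> z"
    have lim: "(q x \<longlongrightarrow> 0) (at z)" for x
    proof -
      have "((\<lambda>y. iexp (y * x) - 1) has_vector_derivative ?d x) (at z)"
        by (auto intro!: derivative_eq_intros simp: Re_exp Im_exp has_vector_derivative_complex_iff)
      then show ?thesis
        by (simp add: has_vector_derivative_def has_derivative_at_within q_def[abs_def]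
            inverse_eq_divide algebra_simps)
    qed
    have "(\<lambda>n. integral\<^sup>L N (\<lambda>x. q x (Y n))) \<longlonglongrightarrow> integral\<^sup>L N (\<lambda>x. 0)"
    \<comment> \<open>The increment of \<open>iexp\<close> and the linear term each contribute at
      most |y - z| |x|, whence the factor 2.\<close>
    proof (rule integral_dominated_convergence[where w="\<lambda>x. 2 * \<bar>x\<bar>"])
      show "AE x in N. (\<lambda>n. q x (Y n)) \<longlonglongrightarrow> 0"
        using lim Y by (auto simp: tendsto_at_iff_sequentially comp_def)
      show "AE x in N. norm (q x (Y n)) \<le> 2 * \<bar>x\<bar>" for n
      proof (rule AE_I2)
        fix x
        have ne: "\<bar>Y n - z\<bar> > 0" using Y by auto
        have "norm (iexp (Y n * x) - 1 - ((iexp (z * x) - 1) + (Y n - z) *\<^sub>R ?d x))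
            \<le> norm (iexp (Y n * x) - iexp (z * x)) + norm ((Y n - z) *\<^sub>R ?d x)"
          by (rule order_trans[OF _ norm_triangle_ineq4]) (simp add: algebra_simps)
        also have "\<dots> \<le> \<bar>Y n * x - z * x\<bar> + \<bar>Y n - z\<bar> * \<bar>x\<bar>"
          by (intro add_mono norm_iexp_diff_le) (auto simp: norm_mult)
        also have "\<dots> = \<bar>Y n - z\<bar> * (2 * \<bar>x\<bar>)"
          by (simp add: abs_mult flip: left_diff_distrib)
        finally show "norm (q x (Y n)) \<le> 2 * \<bar>x\<bar>"
          using ne unfolding q_def norm_scaleR
          by (simp add: field_simps)
      qed
    qed (use int in simp_all)
    then show "(\<lambda>n. integral\<^sup>L N (\<lambda>x. q x (Y n))) \<longlonglongrightarrow> 0" by simp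
  qed
  moreover have "integral\<^sup>L N (\<lambda>x. q x y) = (1 / norm (y - z)) *\<^sub>R
     ((CLINT x|N. iexp (y * x) - 1) - ((CLINT x|N. iexp (z * x) - 1) + (y - z) *\<^sub>R integral\<^sup>L N ?d))" for y
    unfolding q_def
    by (subst integral_scaleR_right, subst Bochner_Integration.integral_diff[OF int_exp],
        (intro Bochner_Integration.integrable_add integrable_scaleR_right int_exp int_d),
        subst Bochner_Integration.integral_add[OF int_exp],
        (intro integrable_scaleR_right int_d), subst integral_scaleR_right, rule refl)
  ultimately show ?thesis
    by (simp add: has_vector_derivative_def has_derivative_at_within bounded_linear_scaleR_left
        inverse_eq_divide diff_diff_eq)
qed

section \<open>Second moments from the characteristic function near 0\<close>

text \<open>The functions 2 (1 - cos (h x)) / h^2 are nonnegative, tend to x^2 as h tends to 0, and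
  have expectation 2 (1 - Re (char M h)) / h^2, which is at most 2 C; Fatou's lemma carries the
  bound over to x^2.\<close>

lemma (in real_distribution) integrable_square_if_char_quadratic:
  assumes C: "\<And>h. 1 - Re (char M h) \<le> C * h\<^sup>2"
  shows "integrable M (\<lambda>x. x\<^sup>2)"
proof -
  define h where "h n = 1 / real (Suc n)" for n
  define u where "u n x = 2 * (1 - cos (h n * x)) / (h n)\<^sup>2" for n and x :: real
  have h_pos: "h n > 0" for n by (simp add: h_def)
  have h_lim: "filterlim h (at 0) sequentially"
    unfolding filterlim_at using h_pos LIMSEQ_inverse_real_of_nat
    by (auto simp: h_def[abs_def] inverse_eq_divide intro!: always_eventually)
  have u_nn: "u n x \<ge> 0" for n x by (simp add: u_def)
  \<comment> \<open>By the half-angle formula \<open>u n x\<close> is 4 (sin (h x / 2) / h)^2, and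
    the quotient tends to the derivative x / 2 of sin (t x / 2) at t = 0.\<close>
  have u_lim: "(\<lambda>n. u n x) \<longlonglongrightarrow> x\<^sup>2" for x
  proof -
    have "((\<lambda>t. sin (t * (x/2)) / t) \<longlongrightarrow> x/2) (at 0)"
    proof -
      have "((\<lambda>t. sin (t * (x/2))) has_real_derivative x/2) (at 0)"
        by (auto intro!: derivative_eq_intros)
      then show ?thesis by (simp add: has_field_derivative_iff)
    qed
    from tendsto_power[OF filterlim_compose[OF this h_lim], of 2]
    have "(\<lambda>n. 4 * (sin (h n * (x/2)) / h n)\<^sup>2) \<longlonglongrightarrow> 4 * (x/2)\<^sup>2"
      by (intro tendsto_mult tendsto_const)
    moreover have "4 * (sin (h n * (x/2)) / h n)\<^sup>2 = u n x" for n
      using cos_double_sin[of "h n * (x/2)"] by (simp add: u_def power_divide)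
    ultimately show ?thesis by (simp add: power_divide)
  qed
  have int_cos: "integrable M (\<lambda>x. cos (t * x))" for t
    by (intro integrable_const_bound[of _ 1]) auto
  have int_u: "integrable M (u n)" for n
    unfolding u_def
    by (intro integrable_divide integrable_mult_right Bochner_Integration.integrable_diff int_cos) auto
  have bound: "(\<integral>\<^sup>+ x. ennreal (u n x) \<partial>M) \<le> ennreal (2 * C)" for n
  proof -
    have "Re (char M (h n)) = (\<integral>x. Re (iexp (h n * x)) \<partial>M)"
      unfolding char_def
      by (rule integral_Re[symmetric]) (auto intro!: integrable_const_bound[of _ 1])
    then have "Re (char M (h n)) = (\<integral>x. cos (h n * x) \<partial>M)"
      by (simp add: Re_exp)
    then have "(\<integral>x. u n x \<partial>M) = 2 * (1 - Re (char M (h n))) / (h n)\<^sup>2"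
      unfolding u_def using int_cos prob_space by simp
    also have "\<dots> \<le> 2 * C"
      using C[of "h n"] h_pos[of n] by (simp add: field_simps)
    finally show ?thesis
      using int_u u_nn by (subst nn_integral_eq_integral) (auto intro: ennreal_leI)
  qed
  have "(\<integral>\<^sup>+ x. ennreal (x\<^sup>2) \<partial>M) = (\<integral>\<^sup>+ x. liminf (\<lambda>n. ennreal (u n x)) \<partial>M)"
    using u_lim by (intro nn_integral_cong lim_imp_Liminf[symmetric]) (auto intro: tendsto_ennrealI)
  also have "\<dots> \<le> liminf (\<lambda>n. \<integral>\<^sup>+ x. ennreal (u n x) \<partial>M)"
    using int_u by (intro nn_integral_liminf) auto
  also have "\<dots> \<le> limsup (\<lambda>n. \<integral>\<^sup>+ x. ennreal (u n x) \<partial>M)"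
    by (intro Liminf_le_Limsup) auto
  also have "\<dots> \<le> ennreal (2 * C)"
    by (intro Limsup_bounded always_eventually allI bound)
  finally show ?thesis
    by (intro integrableI_bounded) (auto simp: less_top[symmetric] top_unique)
qed

section \<open>Fourier uniqueness for finite signed measures\<close>

text \<open>The signed measure in question is the image of w dN under \<open>Y\<close>. Its positive
  and negative weights have equal transforms, hence equal mass, so after normalisation they give two
  probability laws to which \<open>Levy_uniqueness\<close> applies.\<close>

lemma signed_Levy_uniqueness:
  fixes w Y :: "'a \<Rightarrow> real" and f :: "real \<Rightarrow> complex"
  assumes w: "integrable N w" and Y[measurable]: "Y \<in> borel_measurable N"
    and f[measurable]: "f \<in> borel_measurable borel" and bnd: "\<And>x. norm (f x) \<le> C"
    and char0: "\<And>z. (CLINT p|N. w p *\<^sub>R iexp (z * Y p)) = 0"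
  shows "(CLINT p|N. w p *\<^sub>R f (Y p)) = 0"
proof -
  note [measurable] = borel_measurable_integrable[OF w]
  define wp wm where "wp p = max 0 (w p)" and "wm p = max 0 (- w p)" for p
  have [measurable]: "wp \<in> borel_measurable N" "wm \<in> borel_measurable N"
    by (simp_all add: wp_def[abs_def] wm_def[abs_def])
  have int: "integrable N wp" "integrable N wm"
    unfolding wp_def wm_def using w by auto
  have w_eq: "w p = wp p - wm p" for p by (auto simp: wp_def wm_def)
  have nn: "wp p \<ge> 0" "wm p \<ge> 0" for p by (auto simp: wp_def wm_def)
  have split: "(CLINT p|N. w p *\<^sub>R g (Y p)) = (CLINT p|N. wp p *\<^sub>R g (Y p)) - (CLINT p|N. wm p *\<^sub>R g (Y p))"
    if [measurable]: "g \<in> borel_measurable borel" and g: "\<And>x. norm (g x) \<le> B" for g :: "real \<Rightarrow> complex" and B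
  proof -
    have "integrable N (\<lambda>p. v p *\<^sub>R g (Y p))"
      if v: "integrable N v" for v
      using borel_measurable_integrable[OF v] g
      by (intro Bochner_Integration.integrable_bound[OF integrable_mult_left[OF v, of B]])
         (auto simp: abs_mult intro!: mult_left_mono order_trans[OF g])
    with int show ?thesis
      by (simp add: w_eq scaleR_diff_left)
  qed
  have char_eq: "(CLINT p|N. wp p *\<^sub>R iexp (z * Y p)) = (CLINT p|N. wm p *\<^sub>R iexp (z * Y p))" for z
    using split[of "\<lambda>x. iexp (z * x)" 1] char0[of z] by simp
  define m where "m = integral\<^sup>L N wp"
  \<comment> \<open>Equality of the transforms at z = 0 is equality of total masses.\<close>
  have m: "integral\<^sup>L N wm = m"
    using char_eq[of 0] int by (simp add: m_def scaleR_conv_of_real)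
  have "m \<ge> 0" unfolding m_def using nn by simp
  show ?thesis
  proof (cases "m = 0")
    \<comment> \<open>Zero mass cannot be normalised, but then both weights vanish almost
      everywhere.\<close>
    case True
    then have "AE p in N. wp p = 0" "AE p in N. wm p = 0"
      using integral_nonneg_eq_0_iff_AE[of N wp] integral_nonneg_eq_0_iff_AE[of N wm] int nn m
      by (auto simp: m_def)
    then have "AE p in N. w p *\<^sub>R f (Y p) = 0"
      by eventually_elim (simp add: w_eq)
    then show ?thesis by (simp add: integral_eq_zero_AE)
  next
    case False
    with \<open>m \<ge> 0\<close> have "m > 0" by simp
    define D where "D v = distr (density N (\<lambda>p. ennreal (v p / m))) borel Y" for v
    have D_int: "(CLINT x|D v. g x) = (CLINT p|N. v p *\<^sub>R g (Y p)) / m"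
      if [measurable]: "v \<in> borel_measurable N" "g \<in> borel_measurable borel" and "\<And>p. v p \<ge> 0"
      for v and g :: "real \<Rightarrow> complex"
    proof -
      have "(CLINT x|D v. g x) = (CLINT p|N. (v p / m) *\<^sub>R g (Y p))"
        unfolding D_def using that \<open>m > 0\<close> by (simp add: integral_distr integral_density)
      also have "\<dots> = (CLINT p|N. v p *\<^sub>R g (Y p) / m)"
        by (simp add: scaleR_conv_of_real)
      finally show ?thesis by simp
    qed
    have D_dist: "real_distribution (D v)"
      if [measurable]: "v \<in> borel_measurable N" and "integrable N v" "integral\<^sup>L N v = m" "\<And>p. v p \<ge> 0" for v
    proof -
      have "(\<integral>\<^sup>+ p. ennreal (v p / m) \<partial>N) = 1"
        using that \<open>m > 0\<close> by (subst nn_integral_eq_integral) auto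
      then have "prob_space (density N (\<lambda>p. ennreal (v p / m)))"
        by (intro prob_spaceI) (simp add: emeasure_density cong: nn_integral_cong)
      then show ?thesis
        unfolding D_def real_distribution_def real_distribution_axioms_def
        by (auto intro!: prob_space.prob_space_distr)
    qed
    have "D wp = D wm"
    proof (rule Levy_uniqueness)
      show "char (D wp) = char (D wm)"
        by (rule ext) (simp add: char_def D_int nn char_eq del: of_real_mult)
    qed (use D_dist int nn m in \<open>auto simp: m_def\<close>)
    then have "(CLINT p|N. wp p *\<^sub>R f (Y p)) / m = (CLINT p|N. wm p *\<^sub>R f (Y p)) / m"
      using D_int[of wp f] D_int[of wm f] nn
      by (metis \<open>wp \<in> borel_measurable N\<close> \<open>wm \<in> borel_measurable N\<close> f)
    then show ?thesis
      using split[of f, OF f bnd] \<open>m > 0\<close> by simp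
  qed
qed

section \<open>Gamma integrals\<close>

text \<open>The integrand is the modulus of the integrand of Euler's Gamma integral at the real
  argument p + 1 > 0, rescaled by l.\<close>

lemma integrable_powr_exp_half_line:
  assumes "p > -1" "l > (0::real)"
  shows "integrable lborel (\<lambda>u. u powr p * exp (- l * u) * indicator {0<..} u)"
proof -
  have "(\<lambda>t. complex_of_real t powr (complex_of_real (p + 1) - 1) / of_real (exp (l * t)))
      absolutely_integrable_on {0<..}"
    using assms by (intro absolutely_integrable_Gamma_integral) auto
  then have "integrable lebesgue (\<lambda>t. norm (indicator {0<..} t *\<^sub>R
     (complex_of_real t powr (complex_of_real (p + 1) - 1) / of_real (exp (l * t)))))"
    unfolding set_integrable_def by (rule integrable_norm)
  also have "(\<lambda>t. norm (indicator {0<..} t *\<^sub>R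
     (complex_of_real t powr (complex_of_real (p + 1) - 1) / of_real (exp (l * t))))) =
     (\<lambda>u. u powr p * exp (- l * u) * indicator {0<..} u)"
    by (auto simp: fun_eq_iff indicator_def norm_mult norm_inverse norm_powr_real_powr exp_minus divide_inverse)
  finally show ?thesis
    by (subst (asm) integrable_completion) auto
qed


section \<open>Moments and derivative for a characteristic function exp \<psi>\<close>

text \<open>Re \<psi> is nonpositive and O(h^2), by 1 - cos t <= t^2 / 2 and the second moment of
  \<nu>, while Im \<psi> is O(|h|) by the first absolute moment. Together these make 1 - Re (exp
  \<psi>) of order h^2.\<close>

lemma char_exp_integral_square_integrable:
  assumes "real_distribution \<mu>" and [measurable_cong]: "sets \<nu> = sets borel"
    and int1: "integrable \<nu> (\<lambda>u. u)" and int2: "integrable \<nu> (\<lambda>u. u\<^sup>2)"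
    and char_\<mu>: "\<And>z. char \<mu> z = exp (CLINT u|\<nu>. iexp (z * u) - 1)"
  shows "integrable \<mu> (\<lambda>x. x\<^sup>2)"
proof -
  interpret real_distribution \<mu> by fact
  define \<psi> where "\<psi> z = (CLINT u|\<nu>. iexp (z * u) - 1)" for z
  define A where "A = (\<integral>u. \<bar>u\<bar> \<partial>\<nu>)"
  define B where "B = (\<integral>u. u\<^sup>2 \<partial>\<nu>)"
  have int_exp: "integrable \<nu> (\<lambda>u. iexp (z * u) - 1)" for z
    using norm_iexp_diff_le[of "z * x" 0 for x]
    by (intro Bochner_Integration.integrable_bound[OF integrable_mult_right[OF int1, of z]]) auto
  have "1 - Re (char \<mu> h) \<le> (B / 2 + A\<^sup>2 / 2) * h\<^sup>2" for h
  proof -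
    have Re_\<psi>: "Re (\<psi> h) = (\<integral>u. cos (h * u) - 1 \<partial>\<nu>)" and int_cos: "integrable \<nu> (\<lambda>u. cos (h * u) - 1)"
      using integral_Re[OF int_exp[of h]] integrable_Re[OF int_exp[of h]]
      by (simp_all add: \<psi>_def Re_exp)
    have minus_Re: "- Re (\<psi> h) = (\<integral>u. 1 - cos (h * u) \<partial>\<nu>)"
      unfolding Re_\<psi> by (subst Bochner_Integration.integral_minus[symmetric]) simp
    moreover have "0 \<le> (\<integral>u. 1 - cos (h * u) \<partial>\<nu>)"
      by (rule Bochner_Integration.integral_nonneg) simp
    ultimately have Re_le: "Re (\<psi> h) \<le> 0" by linarith
    have "- Re (\<psi> h) = (\<integral>u. 1 - cos (h * u) \<partial>\<nu>)" by (rule minus_Re)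
    also have "\<dots> \<le> (\<integral>u. h\<^sup>2 / 2 * u\<^sup>2 \<partial>\<nu>)"
      using int_cos int2 one_minus_cos_le[of "h * u" for u]
      by (intro integral_mono) (auto simp: power_mult_distrib dest: integrable_minus)
    finally have Re_ge: "- Re (\<psi> h) \<le> B / 2 * h\<^sup>2"
      by (simp add: B_def mult.commute)
    have "\<bar>Im (\<psi> h)\<bar> \<le> norm (\<psi> h)"
      by (rule abs_Im_le_cmod)
    also have "\<dots> \<le> (\<integral>u. \<bar>h\<bar> * \<bar>u\<bar> \<partial>\<nu>)"
      unfolding \<psi>_def using int1 norm_iexp_diff_le[of "h * u" 0 for u]
      by (intro Bochner_Integration.integral_norm_bound_integral int_exp) (auto simp: abs_mult)
    finally have "\<bar>Im (\<psi> h)\<bar> \<le> \<bar>A * h\<bar>"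
      by (simp add: A_def abs_mult mult.commute)
    then have Im_le: "(Im (\<psi> h))\<^sup>2 \<le> A\<^sup>2 * h\<^sup>2"
      by (simp add: abs_le_square_iff power_mult_distrib)
    \<comment> \<open>The split separates the loss of modulus, which Re \<psi> controls linearly,
      from the rotation, which Im \<psi> controls quadratically.\<close>
    have "1 - Re (char \<mu> h) = (1 - exp (Re (\<psi> h))) + exp (Re (\<psi> h)) * (1 - cos (Im (\<psi> h)))"
      unfolding char_\<mu> \<psi>_def[symmetric] by (simp add: Re_exp algebra_simps)
    also have "\<dots> \<le> - Re (\<psi> h) + 1 * ((Im (\<psi> h))\<^sup>2 / 2)"
    proof (intro add_mono mult_mono one_minus_cos_le)
      show "1 - exp (Re (\<psi> h)) \<le> - Re (\<psi> h)"
        using exp_ge_add_one_self[of "Re (\<psi> h)"] by linarith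
    qed (use Re_le in simp_all)
    also have "\<dots> \<le> (B / 2 + A\<^sup>2 / 2) * h\<^sup>2"
      using Re_ge Im_le by (simp add: algebra_simps)
    finally show ?thesis .
  qed
  then show ?thesis by (rule integrable_square_if_char_quadratic)
qed

text \<open>Differentiate \<open>char \<mu>\<close> twice over, once as an integral against \<mu>
  and once by the chain rule through exp; uniqueness of derivatives equates the results, and the
  common factor i cancels.\<close>

lemma char_exp_integral_first_moment:
  assumes "real_distribution \<mu>" and [measurable_cong]: "sets \<nu> = sets borel"
    and int1: "integrable \<nu> (\<lambda>u. u)" and int\<mu>: "integrable \<mu> (\<lambda>x. x)"
    and char_\<mu>: "\<And>z. char \<mu> z = exp (CLINT u|\<nu>. iexp (z * u) - 1)"
  shows "(CLINT x|\<mu>. x * iexp (z * x)) = char \<mu> z * (CLINT u|\<nu>. u * iexp (z * u))"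
proof -
  interpret real_distribution \<mu> by fact
  have "(CLINT x|\<mu>. iexp (y * x) - 1) = char \<mu> y - 1" for y
  proof -
    have "integrable \<mu> (\<lambda>x. iexp (y * x))"
      by (intro integrable_const_bound[of _ 1]) auto
    then show ?thesis
      using prob_space by (simp add: char_def)
  qed
  then have "((\<lambda>y. char \<mu> y - 1) has_vector_derivative (CLINT x|\<mu>. \<i> * x * iexp (z * x))) (at z)"
    using has_vector_derivative_integral_iexp[of \<mu> z] int\<mu> by simp
  from has_vector_derivative_add[OF this has_vector_derivative_const[of 1]]
  have d1: "(char \<mu> has_vector_derivative (CLINT x|\<mu>. \<i> * x * iexp (z * x))) (at z)"
    by simp
  have "(exp \<circ> (\<lambda>y. CLINT u|\<nu>. iexp (y * u) - 1) has_vector_derivative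
      (CLINT u|\<nu>. \<i> * u * iexp (z * u)) * exp (CLINT u|\<nu>. iexp (z * u) - 1)) (at z)"
    by (intro field_vector_diff_chain_at has_vector_derivative_integral_iexp DERIV_exp assms)
  then have "(char \<mu> has_vector_derivative (CLINT u|\<nu>. \<i> * u * iexp (z * u)) * char \<mu> z) (at z)"
    by (simp add: comp_def char_\<mu>[abs_def] del: of_real_mult)
  from vector_derivative_unique_at[OF d1 this]
  have "\<i> * (CLINT x|\<mu>. x * iexp (z * x)) = \<i> * (char \<mu> z * (CLINT u|\<nu>. u * iexp (z * u)))"
    by (simp add: mult.assoc mult.commute del: of_real_mult)
  then show ?thesis by simp
qed

section \<open>From Fourier transforms to bounded test functions\<close>

text \<open>\<open>ft\<close> states that x \<mu>(dx) and the convolution of \<mu> with \<kappa>(u)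
  du have the same Fourier transform; the identity is the equality of these signed measures, tested
  on a bounded \<open>f\<close>.\<close>

lemma size_bias_identity:
  fixes f :: "real \<Rightarrow> complex" and \<kappa> :: "real \<Rightarrow> real"
  assumes "real_distribution \<mu>" and int\<mu>: "integrable \<mu> (\<lambda>x. x)" and int\<kappa>: "integrable lborel \<kappa>"
    and ft: "\<And>z. (CLINT x|\<mu>. x * iexp (z * x)) = char \<mu> z * (CLINT u|lborel. \<kappa> u * iexp (z * u))"
    and f: "f \<in> borel_measurable borel" and bnd: "\<And>x. norm (f x) \<le> C"
  shows "integrable \<mu> (\<lambda>x. CLINT u|lborel. \<kappa> u * f (x + u))" (is ?thesis1)
    and "(CLINT x|\<mu>. x * f x) = (CLINT x|\<mu>. CLINT u|lborel. \<kappa> u * f (x + u))" (is ?thesis2)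
proof -
  interpret real_distribution \<mu> by fact
  interpret P: pair_sigma_finite \<mu> lborel ..
  interpret B: sigma_finite_measure "count_space (UNIV :: bool set)"
    by (rule sigma_finite_measure_count_space)
  interpret Q: pair_sigma_finite "count_space (UNIV :: bool set)" "\<mu> \<Otimes>\<^sub>M lborel" ..
  note [measurable] = borel_measurable_integrable[OF int\<kappa>]
  txt \<open>The flag \<^term>\<open>b\<close> in \<^term>\<open>(b, x, u)\<close> places the signed measures \<open>x \<mu>(dx)\<close> and
    \<open>- \<mu> * \<kappa>\<close> on one space, so that their sum is the image of a single weighted measure; \<open>\<eta>\<close> only
    integrates out the idle variable \<^term>\<open>u\<close>.\<close>
  define \<eta> :: "real \<Rightarrow> real" where "\<eta> = indicator {0..1}"
  have [measurable]: "\<eta> \<in> borel_measurable borel"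
    and \<eta>: "integrable lborel \<eta>" "(\<integral>u. \<eta> u \<partial>lborel) = 1" "\<bar>\<eta> u\<bar> = \<eta> u" for u
    by (simp_all add: \<eta>_def)
  define w where "w = (\<lambda>p. if fst p then fst (snd p) * \<eta> (snd (snd p)) else - \<kappa> (snd (snd p)))"
  define Y where "Y = (\<lambda>p. if fst p then fst (snd p) else fst (snd p) + snd (snd p) :: real)"
  let ?N = "count_space (UNIV :: bool set) \<Otimes>\<^sub>M (\<mu> \<Otimes>\<^sub>M lborel)"
  have [measurable]: "w \<in> borel_measurable ?N" "Y \<in> borel_measurable ?N"
    unfolding w_def Y_def by measurable
  have int1: "integrable (\<mu> \<Otimes>\<^sub>M lborel) (\<lambda>p. fst p * \<eta> (snd p) :: real)"
  proof (rule P.Fubini_integrable)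
    show "(\<lambda>p. fst p * \<eta> (snd p) :: real) \<in> borel_measurable (\<mu> \<Otimes>\<^sub>M lborel)"
      by measurable
  qed (use int\<mu> in \<open>simp_all add: abs_mult \<eta>\<close>)
  have int2: "integrable (\<mu> \<Otimes>\<^sub>M lborel) (\<lambda>p. - \<kappa> (snd p))"
  proof (rule P.Fubini_integrable)
    show "(\<lambda>p. - \<kappa> (snd p)) \<in> borel_measurable (\<mu> \<Otimes>\<^sub>M lborel)"
      by measurable
  qed (use int\<kappa> in simp_all)
  have int_w: "integrable ?N w"
  proof (rule Q.Fubini_integrable)
    show "AE b in count_space UNIV. integrable (\<mu> \<Otimes>\<^sub>M lborel) (\<lambda>p. w (b, p))"
    proof (rule AE_I2)
      show "integrable (\<mu> \<Otimes>\<^sub>M lborel) (\<lambda>p. w (b, p))" for b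
        using int1 int2 by (cases b) (simp_all add: w_def)
    qed
  qed (simp_all add: integrable_count_space)
  have bounded_int: "integrable K (\<lambda>p. v p *\<^sub>R g (y p))"
    if v: "integrable K v" and [measurable]: "y \<in> borel_measurable K" "g \<in> borel_measurable borel"
      and g: "\<And>x. norm (g x) \<le> D"
    for K :: "'k measure" and v and y :: "'k \<Rightarrow> real" and g :: "real \<Rightarrow> complex" and D
    using borel_measurable_integrable[OF v] g
    by (intro Bochner_Integration.integrable_bound[OF integrable_mult_left[OF v, of D]])
       (auto simp: abs_mult intro!: mult_left_mono order_trans[OF g])
  \<comment> \<open>Stated for arbitrary bounded \<open>g\<close> because it is used twice: with
    \<open>iexp\<close> to verify the vanishing transform, and with \<open>f\<close> to read off the
    conclusion.\<close>
  have main: "integrable \<mu> (\<lambda>x. CLINT u|lborel. \<kappa> u * g (x + u))"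
    "(CLINT p|?N. w p *\<^sub>R g (Y p)) = (CLINT x|\<mu>. x * g x) - (CLINT x|\<mu>. CLINT u|lborel. \<kappa> u * g (x + u))"
    if [measurable]: "g \<in> borel_measurable borel" and g: "\<And>x. norm (g x) \<le> D" for g :: "real \<Rightarrow> complex" and D
  proof -
    have int_t: "integrable (\<mu> \<Otimes>\<^sub>M lborel) (\<lambda>p. (fst p * \<eta> (snd p)) *\<^sub>R g (fst p))"
      by (rule bounded_int[OF int1 _ _ g]) auto
    have int_f: "integrable (\<mu> \<Otimes>\<^sub>M lborel) (\<lambda>p. (- \<kappa> (snd p)) *\<^sub>R g (fst p + snd p))"
      by (rule bounded_int[OF int2 _ _ g]) auto
    from P.integrable_fst'[OF int_f]
    show "integrable \<mu> (\<lambda>x. CLINT u|lborel. \<kappa> u * g (x + u))"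
      by (simp add: scaleR_conv_of_real)
    have "(CLINT p|?N. w p *\<^sub>R g (Y p)) =
        (CLINT b|count_space UNIV. CLINT p|\<mu> \<Otimes>\<^sub>M lborel. w (b, p) *\<^sub>R g (Y (b, p)))"
      by (rule Q.integral_fst'[symmetric]) (rule bounded_int[OF int_w _ _ g], auto)
    also have "\<dots> = (CLINT p|\<mu> \<Otimes>\<^sub>M lborel. (fst p * \<eta> (snd p)) *\<^sub>R g (fst p))
        + (CLINT p|\<mu> \<Otimes>\<^sub>M lborel. (- \<kappa> (snd p)) *\<^sub>R g (fst p + snd p))"
      by (simp add: lebesgue_integral_count_space_finite UNIV_bool w_def Y_def split_beta)
    also have "(CLINT p|\<mu> \<Otimes>\<^sub>M lborel. (fst p * \<eta> (snd p)) *\<^sub>R g (fst p))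
        = (CLINT x|\<mu>. x * g x)"
      by (subst P.integral_fst'[OF int_t, symmetric]) (simp add: \<eta> scaleR_conv_of_real)
    also have "(CLINT p|\<mu> \<Otimes>\<^sub>M lborel. (- \<kappa> (snd p)) *\<^sub>R g (fst p + snd p))
        = - (CLINT x|\<mu>. CLINT u|lborel. \<kappa> u * g (x + u))"
      by (subst P.integral_fst'[OF int_f, symmetric]) (simp add: scaleR_conv_of_real)
    finally show "(CLINT p|?N. w p *\<^sub>R g (Y p)) =
        (CLINT x|\<mu>. x * g x) - (CLINT x|\<mu>. CLINT u|lborel. \<kappa> u * g (x + u))"
      by simp
  qed
  have "(CLINT p|?N. w p *\<^sub>R iexp (z * Y p)) = 0" for z
  proof -
    \<comment> \<open>The exponential of a sum factors, so the convolution becomes the product on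
      the right of \<open>ft\<close>.\<close>
    have "(CLINT x|\<mu>. CLINT u|lborel. \<kappa> u * iexp (z * (x + u)))
        = (CLINT x|\<mu>. CLINT u|lborel. iexp (z * x) * (\<kappa> u * iexp (z * u)))"
      by (simp add: algebra_simps exp_add)
    also have "\<dots> = char \<mu> z * (CLINT u|lborel. \<kappa> u * iexp (z * u))"
      by (simp add: char_def del: of_real_mult)
    finally show ?thesis
      using main(2)[of "\<lambda>x. iexp (z * x)" 1] ft[of z] by simp
  qed
  then have "(CLINT p|?N. w p *\<^sub>R f (Y p)) = 0"
    by (intro signed_Levy_uniqueness[OF int_w _ f bnd]) auto
  with main[OF f bnd] show ?thesis1 ?thesis2 by auto
qed

section \<open>Moments of the tempered stable Levy density\<close>

definition tsd_density :: "real \<Rightarrow> real \<Rightarrow> real \<Rightarrow> real \<Rightarrow> real \<Rightarrow> real \<Rightarrow> real \<Rightarrow> real" where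
  "tsd_density ap bp lp am bm lm u =
     ap / (u powr (1 + bp)) * exp (- lp * u) * indicator {0<..} u +
     am / (\<bar>u\<bar> powr (1 + bm)) * exp (- lm * \<bar>u\<bar>) * indicator {..<0} u"

lemma levy_tsd_eq_density:
  "levy_tsd ap bp lp am bm lm = density lborel (\<lambda>u. ennreal (tsd_density ap bp lp am bm lm u))"
  by (simp add: levy_tsd_def tsd_density_def)

lemma tsd_density_measurable [measurable]: "tsd_density ap bp lp am bm lm \<in> borel_measurable borel"
  unfolding tsd_density_def[abs_def] by measurable

lemma tsd_density_nonneg: "0 \<le> ap \<Longrightarrow> 0 \<le> am \<Longrightarrow> 0 \<le> tsd_density ap bp lp am bm lm u"
  by (simp add: tsd_density_def)

text \<open>Each half-line reduces to a Gamma integral with exponent n - (1 + b), which exceeds -1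
  exactly when b < n; the negative half is first reflected to the positive one.\<close>

lemma integrable_tsd_density_moment:
  assumes "0 < lp" "0 < lm" "bp < real n" "bm < real n"
  shows "integrable lborel (\<lambda>u. tsd_density ap bp lp am bm lm u * u ^ n)"
proof -
  define g where "g p l u = u powr p * exp (- l * u) * indicator {0<..} u" for p l u :: real
  have g: "integrable lborel (g p l)" if "p > -1" "l > 0" for p l
    unfolding g_def[abs_def] using that by (rule integrable_powr_exp_half_line)
  \<comment> \<open>The factor (-1)^n restores the sign of u^n after reflection, and
    \<open>0 + (-1) * u\<close> is written in the shape of the affine substitution rule.\<close>
  have "integrable lborel (\<lambda>u. ap * g (real n - (1 + bp)) lp u
      + (-1) ^ n * am * g (real n - (1 + bm)) lm (0 + (-1) * u))"
    using assms
    by (intro Bochner_Integration.integrable_add integrable_mult_right g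
        lborel_integrable_real_affine_iff[THEN iffD2]) auto
  also have "(\<lambda>u. ap * g (real n - (1 + bp)) lp u
      + (-1) ^ n * am * g (real n - (1 + bm)) lm (0 + (-1) * u))
      = (\<lambda>u. tsd_density ap bp lp am bm lm u * u ^ n)"
  proof
    fix u :: real
    consider "u > 0" | "u = 0" | "u < 0" by linarith
    then show "ap * g (real n - (1 + bp)) lp u
      + (-1) ^ n * am * g (real n - (1 + bm)) lm (0 + (-1) * u)
      = tsd_density ap bp lp am bm lm u * u ^ n"
    proof cases
      case 1
      then show ?thesis
        by (simp add: g_def tsd_density_def powr_diff powr_realpow)
    next
      case 3
      then have "(- 1) ^ n * (-u) ^ n = u ^ n"
        by (simp flip: power_mult_distrib)
      with 3 show ?thesis
        by (simp add: g_def tsd_density_def powr_diff powr_realpow field_simps)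
    qed (simp add: g_def tsd_density_def)
  qed
  finally show ?thesis .
qed

section \<open>The Stein identity for tempered stable laws\<close>

theorem theorem3p1:
  fixes M :: "'w measure" and X :: "'w \<Rightarrow> real"
    and ap bp lp am bm lm :: real
    and \<nu> :: "real measure" and f :: "real \<Rightarrow> complex"
  assumes "prob_space M" and "X \<in> borel_measurable M"
    and "0 < ap" and "0 < lp" and "0 < am" and "0 < lm"
    and "0 \<le> bp" and "bp < 1" and "0 \<le> bm" and "bm < 1"
    and "tsd_law (distr M borel X) ap bp lp am bm lm"
    and "\<nu> = levy_tsd ap bp lp am bm lm"
    and "f \<in> schwartz_space"
  shows "(\<forall>x. integrable \<nu> (\<lambda>u. complex_of_real u * f (x + u))) \<and>
    integrable M (\<lambda>w. complex_of_real (X w) * f (X w)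
        - (CLINT u|\<nu>. complex_of_real u * f (X w + u))) \<and>
    (CLINT w|M. complex_of_real (X w) * f (X w)
        - (CLINT u|\<nu>. complex_of_real u * f (X w + u))) = 0"
proof -
  define \<mu> where "\<mu> = distr M borel X"
  define k where "k = tsd_density ap bp lp am bm lm"
  have \<nu>: "\<nu> = density lborel (\<lambda>u. ennreal (k u))"
    by (simp add: assms levy_tsd_eq_density k_def)
  have k[measurable]: "k \<in> borel_measurable borel" and k_nn: "\<And>u. k u \<ge> 0"
    using assms by (auto simp: k_def tsd_density_nonneg)
  have X[measurable]: "X \<in> borel_measurable M" by fact
  have dist: "real_distribution \<mu>" and char_\<mu>: "\<And>z. char \<mu> z = exp (CLINT u|\<nu>. iexp (z * u) - 1)"
    using assms by (auto simp: tsd_law_def \<mu>_def)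
  interpret \<mu>: real_distribution \<mu> by (rule dist)
  have sets_\<nu> [measurable_cong]: "sets \<nu> = sets borel" by (simp add: \<nu>)
  have \<nu>_int: "(CLINT u|\<nu>. g u) = (CLINT u|lborel. k u *\<^sub>R g u)"
    if "g \<in> borel_measurable borel" for g :: "real \<Rightarrow> complex"
    unfolding \<nu> using that k_nn by (subst integral_density) auto
  have int_k: "integrable lborel (\<lambda>u. k u * u ^ n)" if "n \<ge> 1" for n
    unfolding k_def using assms that by (intro integrable_tsd_density_moment) auto
  have mom: "integrable \<nu> (\<lambda>u. u ^ n)" if "n \<ge> 1" for n
    unfolding \<nu> using k_nn int_k[OF that] by (subst integrable_density) auto
  have int_u: "integrable \<nu> (\<lambda>u. u)" and int_u2: "integrable \<nu> (\<lambda>u. u\<^sup>2)" and int_ku: "integrable lborel (\<lambda>u. k u * u)"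
    using mom[of 1] mom[of 2] int_k[of 1] by simp_all
  have int_x: "integrable \<mu> (\<lambda>x. x)"
  proof (rule Bochner_Integration.integrable_bound)
    show "integrable \<mu> (\<lambda>x. 1 + x\<^sup>2)"
      using char_exp_integral_square_integrable[OF dist sets_\<nu> int_u int_u2 char_\<mu>] by simp
    \<comment> \<open>The second moment dominates the first, and it is the first that
      differentiating the characteristic function requires.\<close>
    have "\<bar>x\<bar> \<le> 1 + x\<^sup>2" for x :: real
      using zero_le_power2[of "\<bar>x\<bar> - 1"] by (simp add: power2_diff)
    then show "AE x in \<mu>. norm x \<le> norm (1 + x\<^sup>2)" by (simp add: abs_of_pos add_pos_nonneg)
  qed simp

  \<comment> \<open>The order-zero conditions of \<open>schwartz_space\<close> yield continuity and
    boundedness, which make \<open>f\<close> a test function for the size-bias identity.\<close>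
  have "f differentiable (at x)" for x
  proof -
    have "iter_deriv 0 f differentiable (at x)"
      using assms(13) unfolding schwartz_space_def by blast
    then show ?thesis by (simp add: iter_deriv_def)
  qed
  then have "continuous_on UNIV f"
    by (intro continuous_at_imp_continuous_on ballI differentiable_imp_continuous_within)
  then have f[measurable]: "f \<in> borel_measurable borel"
    by (rule borel_measurable_continuous_onI)
  have "bounded (range (\<lambda>x. x ^ 0 *\<^sub>R iter_deriv 0 f x))"
    using assms(13) unfolding schwartz_space_def by blast
  then obtain C where C: "\<And>x. norm (f x) \<le> C"
    by (auto simp: bounded_iff iter_deriv_def)

  \<comment> \<open>Here \<kappa>(u) = k(u) u, the Lebesgue density of the signed measure u
    \<nu>(du).\<close>
  have ft: "(CLINT x|\<mu>. x * iexp (z * x)) = char \<mu> z * (CLINT u|lborel. (k u * u) * iexp (z * u))" for z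
    using char_exp_integral_first_moment[OF dist sets_\<nu> int_u int_x char_\<mu>, of z]
    by (subst (asm) \<nu>_int) (simp_all add: scaleR_conv_of_real mult.assoc)
  have inner: "(CLINT u|\<nu>. u * f (x + u)) = (CLINT u|lborel. (k u * u) * f (x + u))" for x
    by (subst \<nu>_int) (simp_all add: scaleR_conv_of_real mult.assoc)
  have int_xf: "integrable \<mu> (\<lambda>x. x * f x)"
    using C by (intro Bochner_Integration.integrable_bound[OF integrable_mult_left[OF int_x, of C]])
       (auto simp: norm_mult abs_mult intro!: mult_left_mono order_trans[OF C])
  note id = size_bias_identity[OF dist int_x int_ku ft f C, folded inner]
  have int_diff: "integrable \<mu> (\<lambda>x. x * f x - (CLINT u|\<nu>. u * f (x + u)))"
    by (intro Bochner_Integration.integrable_diff int_xf id)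
  have "(CLINT x|\<mu>. x * f x - (CLINT u|\<nu>. u * f (x + u))) = 0"
    using int_xf id by simp
  moreover have "integrable \<nu> (\<lambda>u. complex_of_real u * f (x + u))" for x
    using C by (intro Bochner_Integration.integrable_bound[OF integrable_mult_left[OF int_u, of C]])
       (auto simp: norm_mult abs_mult intro!: mult_left_mono order_trans[OF C])
  ultimately show ?thesis
    \<comment> \<open>Everything so far concerns the law \<mu>; the change of variables along
      \<open>X\<close> moves it to \<open>M\<close>.\<close>
    using int_diff borel_measurable_integrable[OF int_diff]
    by (simp add: \<mu>_def integrable_distr_eq integral_distr)
qed

end
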